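(* Let $S$ be a finite inverse semigroup with $\mathcal D$-classes $D_0,\dots,D_n$. For each $k$ let $r_k$ be the number of idempotents in $D_k$, choose an idempotent $e_k\in D_k$, let $G_k$ be the maximal subgroup of $S$ at $e_k$, and let $\mathrm{IRR}(G_k)$ be a complete set of inequivalent irreducible representations of $\mathbb C G_k$. Let $\mathcal Y$ be the set of representations of $\mathbb C S$ induced by $\biguplus_{k=0}^n \mathrm{IRR}(G_k)$. Then the number of operations required to compute the inverse Fourier transform of an arbitrary $\mathbb C$-valued function $f$ on $S$ expressed with respect to $\mathcal Y$ is no more than \[ \mathcal C(\mu_S)+\sum_{k=0}^n r_k^2\,\mathcal T_{\mathrm{inv}}(\mathrm{IRR}(G_k)), \] where $\mathcal C(\mu_S)$ is the maximum number of operations required to compute the M\"obius transform of an arbitrary $\mathbb C$-valued function on $S$, and $\mathcal T_{\mathrm{inv}}(\mathrm{IRR}(G_k))$ is the maximum number of operations required to compute the inverse Fourier transform of an arbitrary $\mathbb C$-valued function on $G_k$ expressed with respect to $\mathrm{IRR}(G_k)$.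
   Context: An inverse semigroup is a semigroup $S$ in which each $x$ has a unique $x^{-1}$ with $xx^{-1}x=x$, $x^{-1}xx^{-1}=x^{-1}$. Write $\mathrm{dom}(s)=s^{-1}s$, $\mathrm{ran}(s)=ss^{-1}$. Natural partial order: $t\leq s$ iff $t=es$ for some idempotent $e$; $\mu$ is its M\"obius function. $s\mathrel{\mathcal D}t$ iff there is $x\in S$ with $\mathrm{dom}(x)=\mathrm{ran}(s)$, $\mathrm{ran}(x)=\mathrm{ran}(t)$ (an equivalence relation with classes the $\mathcal D$-classes). The maximal subgroup at an idempotent $e$ is $\{s\in S:\mathrm{dom}(s)=\mathrm{ran}(s)=e\}$. Functions $f:S\to\mathbb C$ are identified with $\sum_s f(s)s\in\mathbb C S$. A representation of $\mathbb C S$ is an algebra homomorphism $\rho:\mathbb C S\to M_{d_\rho}(\mathbb C)$; a complete set of inequivalent irreducible representations has one representative of each equivalence class of irreducible representations. The same terminology applies to groups. Groupoid basis: $\lfloor s\rfloor=\sum_{t\leq s}\mu(t,s)t$ for $s\in S$; these form a basis of $\mathbb C S$. Induced representations: for each idempotent $e\in D_k$ fix $p_e\in S$ with $\mathrm{dom}(p_e)=e_k$, $\mathrm{ran}(p_e)=e$, and $p_{e_k}=e_k$. For $\rho\in\mathrm{IRR}(G_k)$, the representation $\bar\rho$ of $\mathbb C S$ of dimension $r_kd_\rho$ is the linear map with $\bar\rho(\lfloor s\rfloor)=E_{\mathrm{ran}(s),\mathrm{dom}(s)}\otimes\rho(p_{\mathrm{ran}(s)}^{-1}\,s\,p_{\mathrm{dom}(s)})$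 if $s\in D_k$, and $\bar\rho(\lfloor s\rfloor)=0$ otherwise, where $E_{a,b}$ are the $r_k\times r_k$ matrix units indexed by idempotents of $D_k$. Then $\mathcal Y=\{\bar\rho:\rho\in\biguplus_k\mathrm{IRR}(G_k)\}$ is called an induced set of representations; it is a complete set of inequivalent irreducible representations of $\mathbb C S$. Being given $f$ expressed with respect to a complete set $\mathcal X$ of inequivalent irreducible representations means being given all entries of all matrices $\hat f(\rho)=\rho(f)=\sum_s f(s)\rho(s)$, $\rho\in\mathcal X$; computing the inverse Fourier transform of $f$ means computing from these all coefficients $f(s)$, $s\in S$. The M\"obius transform of $g:S\to\mathbb C$ is the collection $\{\sum_{t\geq s}\mu(s,t)g(t):s\in S\}$. Operation: one complex multiplication together with one complex addition, i.e. one step forming $\alpha u+v$, where $\alpha\in\mathbb C$ is a constant and $u,v$ are inputs, previously computed values or $0$. Constants depending only on $S$ and the chosen representations (not on $f$) may be precomputed at no cost. The number of operations required is that of the best algorithm (sequence of such steps) valid for all inputs. *)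

theory Defs
  imports
    "HOL-Library.Extended_Nat"
    "Jordan_Normal_Form.VS_Connect"
    Complex_Main
begin

section \<open>Inverse semigroups\<close>

class inverse_semigroup = semigroup_mult +
  assumes ex1_inverse: "\<exists>!y. x * y * x = x \<and> y * x * y = y"

definition sinv :: "'a::inverse_semigroup \<Rightarrow> 'a" where
  "sinv x = (THE y. x * y * x = x \<and> y * x * y = y)"

definition sdom :: "'a::inverse_semigroup \<Rightarrow> 'a" where
  "sdom s = sinv s * s"

definition sran :: "'a::inverse_semigroup \<Rightarrow> 'a" where
  "sran s = s * sinv s"

definition idems :: "'a::inverse_semigroup set" where
  "idems = {e. e * e = e}"

definition nle :: "'a::inverse_semigroup \<Rightarrow> 'a \<Rightarrow> bool"  (infix \<open>\<preceq>\<close> 50) where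
  "t \<preceq> s \<longleftrightarrow> (\<exists>e\<in>idems. t = e * s)"

definition D_rel :: "('a::inverse_semigroup \<times> 'a) set" where
  "D_rel = {(s, t). \<exists>x. sdom x = sran s \<and> sran x = sran t}"

definition max_subgroup :: "'a::inverse_semigroup \<Rightarrow> 'a set" where
  "max_subgroup e = {s. sdom s = e \<and> sran s = e}"

lemma sinv1: "x * sinv x * x = x" and sinv2: "sinv x * x * sinv x = sinv x"
  using theI'[OF ex1_inverse[of x]] unfolding sinv_def by auto

lemma sinv_unique: "x * y * x = x \<Longrightarrow> y * x * y = y \<Longrightarrow> y = sinv x"
  using ex1_inverse[of x] sinv1[of x] sinv2[of x] by blast

lemma idems_mult:
  assumes e: "e \<in> idems" and f: "f \<in> idems"
  shows "e * f \<in> idems"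
proof -
  let ?x = "sinv (e * f)"
  have ee: "e * e = e" and ff: "f * f = f" using e f by (auto simp: idems_def)
  have e2: "e * (e * z) = e * z" and f2: "f * (f * z) = f * z" for z
    by (simp_all add: ee ff flip: mult.assoc)
  have s1: "e * (f * (?x * (e * f))) = e * f" using sinv1[of "e * f"] by (simp add: mult.assoc)
  have s2: "?x * (e * (f * ?x)) = ?x" using sinv2[of "e * f"] by (simp add: mult.assoc)
  have s2': "?x * (e * (f * (?x * z))) = ?x * z" for z using s2 by (metis mult.assoc)
  have "f * ?x * e = ?x"
    by (rule sinv_unique) (simp_all add: mult.assoc e2 f2 s1 s2')
  then have "?x * ?x = ?x" by (metis mult.assoc s2)
  then have "e * f = ?x"
    by (metis sinv_unique sinv1 sinv2)
  with \<open>?x * ?x = ?x\<close> show ?thesis by (simp add: idems_def)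
qed

lemma idems_commute:
  assumes e: "e \<in> idems" and f: "f \<in> idems"
  shows "e * f = f * e"
proof -
  have ee: "e * e = e" and ff: "f * f = f" using e f by (auto simp: idems_def)
  have e2: "e * (e * z) = e * z" and f2: "f * (f * z) = f * z" for z
    by (simp_all add: ee ff flip: mult.assoc)
  have ef: "e * (f * (e * f)) = e * f" and fe: "f * (e * (f * e)) = f * e"
    using idems_mult[OF e f] idems_mult[OF f e] by (simp_all add: idems_def mult.assoc)
  have "f * e = sinv (e * f)" by (rule sinv_unique) (simp_all add: mult.assoc e2 f2 ef fe)
  moreover have "e * f = sinv (e * f)" by (rule sinv_unique) (simp_all add: mult.assoc e2 f2 ef fe)
  ultimately show ?thesis by simp
qed

lemma nle_refl: "s \<preceq> s"
proof -
  have "sran s \<in> idems" by (simp add: idems_def sran_def mult.assoc[symmetric] sinv1)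
  moreover have "s = sran s * s" by (simp add: sran_def sinv1)
  ultimately show ?thesis unfolding nle_def by blast
qed

lemma nle_trans: "s \<preceq> t \<Longrightarrow> t \<preceq> u \<Longrightarrow> s \<preceq> u"
  unfolding nle_def by (metis idems_mult mult.assoc)

lemma nle_antisym:
  assumes "s \<preceq> t" "t \<preceq> s"
  shows "s = t"
proof -
  obtain e f where e: "e \<in> idems" "s = e * t" and f: "f \<in> idems" "t = f * s"
    using assms unfolding nle_def by blast
  have "e * e = e" using e(1) by (simp add: idems_def)
  then have "e * s = s" unfolding e(2) by (simp only: mult.assoc[symmetric])
  have "s = e * (f * s)" using e(2) f(2) by simp
  also have "\<dots> = f * (e * s)" using idems_commute[OF e(1) f(1)] by (simp flip: mult.assoc)
  also have "\<dots> = t" using \<open>e * s = s\<close> f(2) by simp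
  finally show ?thesis .
qed

text \<open>The Moebius function of the natural partial order, by its usual recursion
  on the upper end of the interval.\<close>

function mobius :: "'a::{inverse_semigroup, finite} \<Rightarrow> 'a \<Rightarrow> int" where
  "mobius s t =
    (if s = t then 1
     else if s \<preceq> t then - (\<Sum>u | s \<preceq> u \<and> u \<preceq> t \<and> u \<noteq> t. mobius s u)
     else 0)"
  by auto
termination
proof (relation "measure (\<lambda>(s, t). card {u. u \<preceq> t})", goal_cases)
  case (2 s t u)
  then have "{v. v \<preceq> u} \<subset> {v. v \<preceq> t}" using nle_refl nle_trans nle_antisym by blast
  then show ?case by (simp add: psubset_card_mono)
qed simp

declare mobius.simps [simp del]

section \<open>Semigroup algebras and their representations\<close>

text \<open>For a subsemigroup \<open>A\<close>, the algebra \<open>\<complex>A\<close> is realised inside the functions on the ambient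
  finite type as the functions vanishing off \<open>A\<close>.  In particular a function on a maximal subgroup
  is extended by zero.\<close>

definition salg :: "'a set \<Rightarrow> ('a \<Rightarrow> complex) set" where
  "salg A = {f. \<forall>s. s \<notin> A \<longrightarrow> f s = 0}"

definition conv :: "('a::{semigroup_mult, finite} \<Rightarrow> complex) \<Rightarrow> ('a \<Rightarrow> complex) \<Rightarrow> 'a \<Rightarrow> complex" where
  "conv f g = (\<lambda>s. \<Sum>(a, b) | a * b = s. f a * g b)"

definition elem :: "'a \<Rightarrow> 'a \<Rightarrow> complex" where
  "elem s = (\<lambda>t. if t = s then 1 else 0)"

type_synonym 'a rep = "('a \<Rightarrow> complex) \<Rightarrow> complex mat"

definition rep_dim :: "'a rep \<Rightarrow> nat" where
  "rep_dim \<rho> = dim_row (\<rho> (\<lambda>_. 0))"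

definition linear_on_salg :: "'a set \<Rightarrow> nat \<Rightarrow> 'a rep \<Rightarrow> bool" where
  "linear_on_salg A d \<rho> \<longleftrightarrow>
     (\<forall>f\<in>salg A. \<rho> f \<in> carrier_mat d d) \<and>
     (\<forall>f\<in>salg A. \<forall>g\<in>salg A. \<rho> (\<lambda>s. f s + g s) = \<rho> f + \<rho> g) \<and>
     (\<forall>c. \<forall>f\<in>salg A. \<rho> (\<lambda>s. c * f s) = c \<cdot>\<^sub>m \<rho> f)"

definition representation :: "'a::{semigroup_mult, finite} set \<Rightarrow> 'a rep \<Rightarrow> bool" where
  "representation A \<rho> \<longleftrightarrow>
     linear_on_salg A (rep_dim \<rho>) \<rho> \<and>
     (\<forall>f\<in>salg A. \<forall>g\<in>salg A. \<rho> (conv f g) = \<rho> f * \<rho> g)"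

text \<open>The identity of the algebra is not required to act as the identity matrix.  Since the zero
  representation is excluded here, irreducible representations do have this property.\<close>

definition irreducible_rep :: "'a::{semigroup_mult, finite} set \<Rightarrow> 'a rep \<Rightarrow> bool" where
  "irreducible_rep A \<rho> \<longleftrightarrow>
     representation A \<rho> \<and>
     (\<exists>f\<in>salg A. \<rho> f \<noteq> 0\<^sub>m (rep_dim \<rho>) (rep_dim \<rho>)) \<and>
     (\<forall>W. VectorSpace.subspace class_ring W (module_vec TYPE(complex) (rep_dim \<rho>)) \<longrightarrow>
          (\<forall>f\<in>salg A. \<forall>w\<in>W. \<rho> f *\<^sub>v w \<in> W) \<longrightarrow>
          W = {0\<^sub>v (rep_dim \<rho>)} \<or> W = carrier_vec (rep_dim \<rho>))"

definition equivalent_rep :: "'a set \<Rightarrow> 'a rep \<Rightarrow> 'a rep \<Rightarrow> bool" where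
  "equivalent_rep A \<rho> \<sigma> \<longleftrightarrow>
     rep_dim \<rho> = rep_dim \<sigma> \<and>
     (\<exists>P \<in> carrier_mat (rep_dim \<rho>) (rep_dim \<rho>).
        invertible_mat P \<and> (\<forall>f\<in>salg A. P * \<rho> f = \<sigma> f * P))"

definition complete_irreps :: "'a::{semigroup_mult, finite} set \<Rightarrow> 'a rep set \<Rightarrow> bool" where
  "complete_irreps A X \<longleftrightarrow>
     (\<forall>\<rho>\<in>X. irreducible_rep A \<rho>) \<and>
     (\<forall>\<rho>\<in>X. \<forall>\<sigma>\<in>X. equivalent_rep A \<rho> \<sigma> \<longrightarrow> \<rho> = \<sigma>) \<and>
     (\<forall>\<rho>. irreducible_rep A \<rho> \<longrightarrow> (\<exists>\<sigma>\<in>X. equivalent_rep A \<rho> \<sigma>))"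

section \<open>Induced representations\<close>

definition groupoid_basis :: "'a::{inverse_semigroup, finite} \<Rightarrow> 'a \<Rightarrow> complex"  (\<open>\<lfloor>_\<rfloor>\<^sub>G\<close>) where
  "\<lfloor>s\<rfloor>\<^sub>G = (\<lambda>u. \<Sum>t | t \<preceq> s. of_int (mobius t s) * elem t u)"

definition kronecker :: "'b::times mat \<Rightarrow> 'b mat \<Rightarrow> 'b mat" where
  "kronecker A B = mat (dim_row A * dim_row B) (dim_col A * dim_col B)
     (\<lambda>(i, j). A $$ (i div dim_row B, j div dim_col B) * B $$ (i mod dim_row B, j mod dim_col B))"

definition mat_unit :: "nat \<Rightarrow> nat \<Rightarrow> nat \<Rightarrow> complex mat" where
  "mat_unit r a b = mat r r (\<lambda>ij. if ij = (a, b) then 1 else 0)"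

text \<open>\<open>is_induced p idx D \<rho> \<sigma>\<close>: \<open>\<sigma>\<close> is the representation of \<open>\<complex>S\<close> induced by \<open>\<rho>\<close> from the maximal
  subgroup chosen in the \<open>\<D>\<close>-class \<open>D\<close>, where \<open>p\<close> gives the connecting elements and \<open>idx\<close> numbers
  the idempotents of \<open>D\<close> (the rows and columns of the matrix units).  As the \<open>\<lfloor>s\<rfloor>\<^sub>G\<close> form a basis,
  there is exactly one such \<open>\<sigma>\<close>.\<close>

definition is_induced ::
  "('a \<Rightarrow> 'a) \<Rightarrow> ('a \<Rightarrow> nat) \<Rightarrow> 'a::{inverse_semigroup, finite} set \<Rightarrow> 'a rep \<Rightarrow> 'a rep \<Rightarrow> bool" where
  "is_induced p idx D \<rho> \<sigma> \<longleftrightarrow>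
     (let r = card (D \<inter> idems); N = r * rep_dim \<rho> in
        linear_on_salg UNIV N \<sigma> \<and>
        (\<forall>s. \<sigma> \<lfloor>s\<rfloor>\<^sub>G =
           (if s \<in> D
            then kronecker (mat_unit r (idx (sran s)) (idx (sdom s)))
                   (\<rho> (elem (sinv (p (sran s)) * s * p (sdom s))))
            else 0\<^sub>m N N)))"

section \<open>Operation counts\<close>

text \<open>Straight-line programs.  A step \<open>(\<alpha>, u, v)\<close> forms \<open>\<alpha> * u + v\<close>; \<open>Val j\<close> refers to the result of
  the step number \<open>j\<close>.\<close>

datatype 'i operand = Zero | Inp 'i | Val nat

type_synonym 'i program = "(complex \<times> 'i operand \<times> 'i operand) list"

fun operand_ok :: "'i set \<Rightarrow> nat \<Rightarrow> 'i operand \<Rightarrow> bool" where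
  "operand_ok I m Zero = True"
| "operand_ok I m (Inp i) = (i \<in> I)"
| "operand_ok I m (Val j) = (j < m)"

definition program_ok :: "'i set \<Rightarrow> 'i program \<Rightarrow> bool" where
  "program_ok I P \<longleftrightarrow>
     (\<forall>k<length P. case P ! k of (\<alpha>, u, v) \<Rightarrow> operand_ok I k u \<and> operand_ok I k v)"

fun operand_value :: "('i \<Rightarrow> complex) \<Rightarrow> complex list \<Rightarrow> 'i operand \<Rightarrow> complex" where
  "operand_value x vs Zero = 0"
| "operand_value x vs (Inp i) = x i"
| "operand_value x vs (Val j) = vs ! j"

fun run :: "('i \<Rightarrow> complex) \<Rightarrow> complex list \<Rightarrow> 'i program \<Rightarrow> complex list" where
  "run x vs [] = vs"
| "run x vs ((\<alpha>, u, v) # P) = run x (vs @ [\<alpha> * operand_value x vs u + operand_value x vs v]) P"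

text \<open>A computational problem consists of a set \<open>F\<close> of instances, input data \<open>inp f i\<close> for \<open>i \<in> I\<close> and
  required output \<open>out f j\<close> for \<open>j \<in> J\<close>.  The program, its constants and the places \<open>q j\<close> where the
  results are found do not depend on the instance.  If no program exists, the count is \<open>\<infinity>\<close>.\<close>

definition computes ::
  "'f set \<Rightarrow> 'i set \<Rightarrow> ('f \<Rightarrow> 'i \<Rightarrow> complex) \<Rightarrow> 'j set \<Rightarrow> ('f \<Rightarrow> 'j \<Rightarrow> complex) \<Rightarrow> 'i program \<Rightarrow> bool" where
  "computes F I inp J out P \<longleftrightarrow>
     program_ok I P \<and>
     (\<exists>q. (\<forall>j\<in>J. operand_ok I (length P) (q j)) \<and>
          (\<forall>f\<in>F. \<forall>j\<in>J. operand_value (inp f) (run (inp f) [] P) (q j) = out f j))"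

definition ops_required ::
  "'f set \<Rightarrow> 'i set \<Rightarrow> ('f \<Rightarrow> 'i \<Rightarrow> complex) \<Rightarrow> 'j set \<Rightarrow> ('f \<Rightarrow> 'j \<Rightarrow> complex) \<Rightarrow> enat" where
  "ops_required F I inp J out = (INF P \<in> {P. computes F I inp J out P}. enat (length P))"

definition ift_ops :: "'a set \<Rightarrow> 'a rep set \<Rightarrow> enat" where
  "ift_ops A X =
     ops_required (salg A)
       {(\<rho>, i, j). \<rho> \<in> X \<and> i < rep_dim \<rho> \<and> j < rep_dim \<rho>} (\<lambda>f (\<rho>, i, j). \<rho> f $$ (i, j))
       A (\<lambda>f s. f s)"

definition mobius_ops :: "'a::{inverse_semigroup, finite} itself \<Rightarrow> enat" where
  "mobius_ops _ =
     ops_required (UNIV :: ('a \<Rightarrow> complex) set) UNIV (\<lambda>g s. g s)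
       UNIV (\<lambda>g s. \<Sum>t | s \<preceq> t. of_int (mobius s t) * g t)"

end

theory Submission
  imports Defs
begin

text \<open>
  Write \<open>F t\<close> for the sum of \<open>f s\<close> over all \<open>s \<succeq> t\<close>.  Moebius inversion shows that \<open>F\<close> lists the
  coefficients of \<open>f\<close> in the groupoid basis, and that the Moebius transform of \<open>F\<close> is \<open>f\<close>.  So it
  suffices to obtain \<open>F\<close> from the matrices \<open>\<sigma> f\<close> with \<open>r\<^sub>k\<^sup>2\<close> inverse transforms on \<open>G\<^sub>k\<close> for each
  \<open>k\<close>, and then to apply one Moebius transform.

  An induced representation is given on the groupoid basis, so \<open>\<sigma> f\<close> can be read off from \<open>F\<close>.
  Let \<open>a\<close> and \<open>b\<close> be idempotents of \<open>D\<^sub>k\<close>.  Only the \<open>s\<close> with range \<open>a\<close> and domain \<open>b\<close> contribute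
  to the block of \<open>\<sigma> f\<close> at \<open>(a, b)\<close>, and \<open>s \<mapsto> sinv (p a) * s * p b\<close> identifies these \<open>s\<close> with the
  elements of \<open>G\<^sub>k\<close> (\<open>bij_betw_max_subgroup\<close>).  If \<open>\<sigma>\<close> is induced by \<open>\<rho>\<close>, the block therefore is
  \<open>\<rho> F\<^sub>a\<^sub>b\<close>, where \<open>F\<^sub>a\<^sub>b g = F (p a * g * sinv (p b))\<close> (\<open>induced_rep_block\<close>).  The blocks at
  \<open>(a, b)\<close> of all the \<open>\<sigma>\<close> induced from \<open>G\<^sub>k\<close> are thus the Fourier transform of the function
  \<open>F\<^sub>a\<^sub>b\<close> on \<open>G\<^sub>k\<close>, and one inverse transform on \<open>G\<^sub>k\<close> returns the values of \<open>F\<close> at these \<open>s\<close>.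
  No arithmetic is spent on cutting out blocks or on renaming group elements.

  The counts add up because an optimal program for a subproblem can be appended to a program that
  provides its inputs (\<open>ops_required_append\<close>).  Subproblems without any program have count
  \<open>\<infinity>\<close>, which makes the corresponding bound trivial.
\<close>

section \<open>Inverse semigroups\<close>

lemma sinv_sinv [simp]: "sinv (sinv x) = x"
  by (metis sinv1 sinv2 sinv_unique)

lemma sdom_in_idems: "sdom s \<in> idems"
  by (simp add: idems_def sdom_def mult.assoc[symmetric] sinv2)

lemma sran_in_idems: "sran s \<in> idems"
  by (simp add: idems_def sran_def mult.assoc[symmetric] sinv1)

lemma mult_sdom: "s * sdom s = s"
  by (simp add: sdom_def mult.assoc[symmetric] sinv1)

lemma sran_mult: "sran s * s = s"
  by (simp add: sran_def sinv1)

lemma sdom_sinv [simp]: "sdom (sinv s) = sran s"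
  by (simp add: sdom_def sran_def)

lemma sran_sinv [simp]: "sran (sinv s) = sdom s"
  by (simp add: sdom_def sran_def)

lemma sinv_idem: "e \<in> idems \<Longrightarrow> sinv e = e"
  by (rule sinv_unique[symmetric]) (simp_all add: idems_def)

lemma sdom_idem: "e \<in> idems \<Longrightarrow> sdom e = e"
  by (simp add: sdom_def sinv_idem) (simp add: idems_def)

lemma sran_idem: "e \<in> idems \<Longrightarrow> sran e = e"
  by (simp add: sran_def sinv_idem) (simp add: idems_def)

lemma sinv_mult: "sinv (x * y) = sinv y * sinv x"
proof (rule sinv_unique[symmetric])
  have comm: "sran y * sdom x = sdom x * sran y"
    by (rule idems_commute[OF sran_in_idems sdom_in_idems])
  have "x * y * (sinv y * sinv x) * (x * y) = x * (sran y * sdom x) * y"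
    by (simp add: sran_def sdom_def mult.assoc)
  also have "\<dots> = (x * sdom x) * (sran y * y)" by (simp add: comm mult.assoc)
  finally show "x * y * (sinv y * sinv x) * (x * y) = x * y"
    by (simp add: mult_sdom sran_mult)
  have "sinv y * sinv x * (x * y) * (sinv y * sinv x) = sinv y * (sdom x * sran y) * sinv x"
    by (simp add: sran_def sdom_def mult.assoc)
  also have "\<dots> = (sinv y * sran y) * (sdom x * sinv x)" by (simp add: comm[symmetric] mult.assoc)
  finally show "sinv y * sinv x * (x * y) * (sinv y * sinv x) = sinv y * sinv x"
    by (metis mult_sdom sdom_sinv sran_mult sran_sinv)
qed

lemma sdom_mult:
  assumes "sdom x = sran y"
  shows "sdom (x * y) = sdom y"
proof -
  have "sdom (x * y) = sinv y * (sdom x * y)" by (simp add: sdom_def sinv_mult mult.assoc)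
  then show ?thesis by (simp add: assms sran_mult) (simp add: sdom_def)
qed

lemma sran_mult_eq:
  assumes "sdom x = sran y"
  shows "sran (x * y) = sran x"
proof -
  have "sran (x * y) = x * sran y * sinv x" by (simp add: sran_def sinv_mult mult.assoc)
  then show ?thesis by (simp add: assms[symmetric] mult_sdom) (simp add: sran_def)
qed

text \<open>If \<open>x\<close> connects \<open>s\<close> to \<open>t\<close> and \<open>y\<close> connects \<open>t\<close> to \<open>u\<close>, then \<open>y * x\<close> connects \<open>s\<close> to \<open>u\<close>, and
  \<open>sinv x\<close> connects \<open>t\<close> to \<open>s\<close>.\<close>

lemma equiv_D_rel: "equiv UNIV D_rel"
proof (rule equivI)
  show "refl D_rel"
    by (rule reflI) (auto simp: D_rel_def intro!: exI[of _ "sran _"] sdom_idem sran_idem sran_in_idems)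
  show "sym D_rel"
    by (rule symI) (auto simp: D_rel_def, metis sdom_sinv sran_sinv)
  show "trans D_rel"
  proof (rule transI)
    fix s t u assume "(s, t) \<in> D_rel" "(t, u) \<in> D_rel"
    then obtain x y where "sdom x = sran s" "sran x = sran t" "sdom y = sran t" "sran y = sran u"
      by (auto simp: D_rel_def)
    then have "sdom (y * x) = sran s" "sran (y * x) = sran u"
      by (simp_all add: sdom_mult sran_mult_eq)
    then show "(s, u) \<in> D_rel" by (auto simp: D_rel_def)
  qed
qed auto

lemma D_class_closed:
  assumes "D \<in> UNIV // D_rel" "s \<in> D" "(s, t) \<in> D_rel"
  shows "t \<in> D"
  using assms equiv_D_rel by (meson in_quotient_imp_closed)

lemma D_rel_sran: "(s, sran s) \<in> D_rel"
  unfolding D_rel_def using sdom_idem[OF sran_in_idems] sran_idem[OF sran_in_idems] by blast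

lemma D_rel_sdom: "(s, sdom s) \<in> D_rel"
  unfolding D_rel_def by (auto intro!: exI[of _ "sinv s"] simp: sran_idem sdom_in_idems)

lemma sran_in_D_class: "D \<in> UNIV // D_rel \<Longrightarrow> s \<in> D \<Longrightarrow> sran s \<in> D \<inter> idems"
  using D_class_closed D_rel_sran sran_in_idems by blast

lemma sdom_in_D_class: "D \<in> UNIV // D_rel \<Longrightarrow> s \<in> D \<Longrightarrow> sdom s \<in> D \<inter> idems"
  using D_class_closed D_rel_sdom sdom_in_idems by blast

lemma in_D_class_if_sran_in:
  assumes "D \<in> UNIV // D_rel" "sran s \<in> D"
  shows "s \<in> D"
  using D_class_closed[OF assms] D_rel_sran[of s] equiv_D_rel by (meson equivE symE)

text \<open>Every Green \<open>\<H>\<close>-class inside a \<open>\<D>\<close>-class is a copy of the maximal subgroup.  Multiplying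
  by the connecting elements \<open>x\<close> and \<open>y\<close> translates one to the other, because
  \<open>x * sinv x\<close> and \<open>y * sinv y\<close> are the two identities of the class.\<close>

lemma bij_betw_max_subgroup:
  assumes x: "sdom x = e" "sran x = a" and y: "sdom y = e" "sran y = b"
  shows "bij_betw (\<lambda>s. sinv x * s * y) {s. sran s = a \<and> sdom s = b} (max_subgroup e)"
proof (rule bij_betw_byWitness[where f' = "\<lambda>g. x * g * sinv y"])
  show "\<forall>s\<in>{s. sran s = a \<and> sdom s = b}. x * (sinv x * s * y) * sinv y = s"
  proof clarify
    fix s assume "a = sran s" "b = sdom s"
    then have "x * sinv x * s * (y * sinv y) = s"
      using x y by (metis mult_sdom sran_mult sran_def)
    then show "x * (sinv x * s * y) * sinv y = s" by (simp add: mult.assoc)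
  qed
  show "\<forall>g\<in>max_subgroup e. sinv x * (x * g * sinv y) * y = g"
  proof
    fix g assume "g \<in> max_subgroup e"
    then have "sinv x * x * g * (sinv y * y) = g"
      using x y unfolding max_subgroup_def by (metis (mono_tags) mem_Collect_eq mult_sdom sran_mult sdom_def)
    then show "sinv x * (x * g * sinv y) * y = g" by (simp add: mult.assoc)
  qed
  show "(\<lambda>s. sinv x * s * y) ` {s. sran s = a \<and> sdom s = b} \<subseteq> max_subgroup e"
    using x y by (auto simp: max_subgroup_def sdom_mult sran_mult_eq)
  show "(\<lambda>g. x * g * sinv y) ` max_subgroup e \<subseteq> {s. sran s = a \<and> sdom s = b}"
    using x y by (auto simp: max_subgroup_def sdom_mult sran_mult_eq)
qed

section \<open>Moebius inversion\<close>

definition upper_sum :: "('a::{inverse_semigroup, finite} \<Rightarrow> complex) \<Rightarrow> 'a \<Rightarrow> complex" where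
  "upper_sum f s = (\<Sum>t | s \<preceq> t. f t)"

definition mobius_transform :: "('a::{inverse_semigroup, finite} \<Rightarrow> complex) \<Rightarrow> 'a \<Rightarrow> complex" where
  "mobius_transform g s = (\<Sum>t | s \<preceq> t. of_int (mobius s t) * g t)"

lemma mobius_self [simp]: "mobius s s = 1"
  by (simp add: mobius.simps)

lemma sum_mobius_interval:
  assumes "s \<preceq> t"
  shows "(\<Sum>u | s \<preceq> u \<and> u \<preceq> t. mobius s u) = (if s = t then 1 else 0)"
proof (cases "s = t")
  case True
  then have "{u. s \<preceq> u \<and> u \<preceq> t} = {s}" using nle_refl nle_antisym by blast
  with True show ?thesis by simp
next
  case False
  have "{u. s \<preceq> u \<and> u \<preceq> t} = insert t {u. s \<preceq> u \<and> u \<preceq> t \<and> u \<noteq> t}"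
    using assms nle_refl by blast
  with False assms show ?thesis by (simp add: mobius.simps[of s t])
qed

text \<open>Exchanging the two sums leaves at \<open>f t\<close> the factor \<open>\<Sum>u | s \<preceq> u \<and> u \<preceq> t. mobius s u\<close>, which
  the defining recursion evaluates.\<close>

lemma mobius_transform_upper_sum: "mobius_transform (upper_sum f) s = f s"
proof -
  have "mobius_transform (upper_sum f) s =
      (\<Sum>u\<in>UNIV. \<Sum>t\<in>UNIV. if s \<preceq> u \<and> u \<preceq> t then of_int (mobius s u) * f t else 0)"
  proof -
    have "(\<Sum>t\<in>UNIV. if s \<preceq> u \<and> u \<preceq> t then of_int (mobius s u) * f t else 0)
        = (if s \<preceq> u then of_int (mobius s u) * upper_sum f u else 0)" for u
      by (simp add: upper_sum_def sum_distrib_left sum.inter_filter[symmetric])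
    then show ?thesis by (simp add: mobius_transform_def sum.inter_filter[symmetric])
  qed
  also have "\<dots> = (\<Sum>t\<in>UNIV. \<Sum>u\<in>UNIV. if s \<preceq> u \<and> u \<preceq> t then of_int (mobius s u) * f t else 0)"
    by (rule sum.swap)
  also have "\<dots> = (\<Sum>t\<in>UNIV. of_int (\<Sum>u | s \<preceq> u \<and> u \<preceq> t. mobius s u) * f t)"
    by (simp add: sum.inter_filter[symmetric] sum_distrib_right)
  also have "\<dots> = (\<Sum>t\<in>UNIV. if t = s then f t else 0)"
  proof (intro sum.cong refl)
    fix t
    show "of_int (\<Sum>u | s \<preceq> u \<and> u \<preceq> t. mobius s u) * f t = (if t = s then f t else 0)"
    proof (cases "s \<preceq> t")
      case True
      then show ?thesis by (simp only: sum_mobius_interval[OF True]) simp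
    next
      case False
      then have "{u. s \<preceq> u \<and> u \<preceq> t} = {}" "t \<noteq> s" using nle_trans nle_refl by blast+
      then show ?thesis by (simp only:) simp
    qed
  qed
  also have "\<dots> = f s" by simp
  finally show ?thesis .
qed

lemma mobius_transform_diff:
  "mobius_transform (\<lambda>s. g s - h s) s = mobius_transform g s - mobius_transform h s"
  by (simp add: mobius_transform_def algebra_simps sum_subtractf)

text \<open>The transform is unitriangular: at a maximal point of the support of \<open>g\<close> it returns
  the value of \<open>g\<close>.\<close>

lemma mobius_transform_eq_0:
  assumes "\<And>s. mobius_transform g s = 0"
  shows "g s = 0"
proof (induction "card {t. s \<preceq> t}" arbitrary: s rule: less_induct)
  case less
  have "g t = 0" if "s \<preceq> t" "t \<noteq> s" for t
  proof (rule less)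
    have "{u. t \<preceq> u} \<subset> {u. s \<preceq> u}" using that nle_refl nle_trans nle_antisym by blast
    then show "card {u. t \<preceq> u} < card {u. s \<preceq> u}" by (simp add: psubset_card_mono)
  qed
  then have "mobius_transform g s = (\<Sum>t | s \<preceq> t. if t = s then g t else 0)"
    unfolding mobius_transform_def by (intro sum.cong refl) auto
  also have "\<dots> = g s" by (simp add: nle_refl)
  finally show "g s = 0" using assms by simp
qed

text \<open>The transform is a left inverse of \<open>upper_sum\<close>, so \<open>g\<close> and \<open>upper_sum (mobius_transform g)\<close>
  have the same transform; as the transform is injective, they agree.\<close>

lemma upper_sum_mobius_transform: "upper_sum (mobius_transform g) s = g s"
proof -
  have "upper_sum (mobius_transform g) s - g s = 0"
    by (rule mobius_transform_eq_0)
       (simp add: mobius_transform_diff mobius_transform_upper_sum)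
  then show ?thesis by simp
qed

lemma groupoid_basis_eq: "\<lfloor>s\<rfloor>\<^sub>G = mobius_transform (elem s)"
  by (rule ext) (simp add: groupoid_basis_def mobius_transform_def elem_def if_distrib cong: if_cong)

text \<open>As \<open>upper_sum\<close> is linear and invertible, \<open>upper_sum f\<close> is the coordinate function of \<open>f\<close>
  in the groupoid basis.\<close>

lemma upper_sum_groupoid_basis: "upper_sum \<lfloor>s\<rfloor>\<^sub>G = elem s"
  by (rule ext) (simp add: groupoid_basis_eq upper_sum_mobius_transform)


section \<open>Composition of straight-line programs\<close>

text \<open>The code of a subroutine is moved behind a program of length \<open>m\<close>: \<open>loc\<close> says where each
  input of the subroutine is found, and references to its own results shift by \<open>m\<close>.\<close>

fun relocate_operand :: "('j \<Rightarrow> 'i operand) \<Rightarrow> nat \<Rightarrow> 'j operand \<Rightarrow> 'i operand" where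
  "relocate_operand loc m Zero = Zero"
| "relocate_operand loc m (Inp i) = loc i"
| "relocate_operand loc m (Val j) = Val (m + j)"

definition relocate :: "('j \<Rightarrow> 'i operand) \<Rightarrow> nat \<Rightarrow> 'j program \<Rightarrow> 'i program" where
  "relocate loc m = map (\<lambda>(\<alpha>, u, v). (\<alpha>, relocate_operand loc m u, relocate_operand loc m v))"

lemma length_relocate [simp]: "length (relocate loc m P) = length P"
  by (simp add: relocate_def)

lemma run_append: "run x vs (P @ Q) = run x (run x vs P) Q"
  by (induction x vs P rule: run.induct) auto

lemma length_run [simp]: "length (run x vs P) = length vs + length P"
  by (induction x vs P rule: run.induct) auto

lemma operand_ok_mono: "operand_ok I m u \<Longrightarrow> m \<le> m' \<Longrightarrow> operand_ok I m' u"
  by (cases u) auto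

lemma operand_value_append:
  "operand_ok I (length vs) u \<Longrightarrow> operand_value x (vs @ ws) u = operand_value x vs u"
  by (cases u) (auto simp: nth_append)

lemma operand_ok_relocate:
  assumes "operand_ok I' k u" "\<And>i. i \<in> I' \<Longrightarrow> operand_ok I m (loc i)"
  shows "operand_ok I (m + k) (relocate_operand loc m u)"
  using assms by (cases u) (simp_all add: operand_ok_mono[where m = m])

lemma operand_value_relocate:
  assumes "operand_ok I' k u" "k \<le> length ws"
    and "\<And>i. i \<in> I' \<Longrightarrow> operand_ok I (length vs) (loc i)"
    and "\<And>i. i \<in> I' \<Longrightarrow> operand_value x vs (loc i) = y i"
  shows "operand_value x (vs @ ws) (relocate_operand loc (length vs) u) = operand_value y ws u"
  using assms by (cases u) (simp_all add: nth_append operand_value_append[where I = I])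

lemma program_ok_append_relocate:
  assumes Q: "program_ok I Q" and P: "program_ok I' P"
    and loc: "\<And>i. i \<in> I' \<Longrightarrow> operand_ok I (length Q) (loc i)"
  shows "program_ok I (Q @ relocate loc (length Q) P)"
  unfolding program_ok_def
proof (intro allI impI)
  fix k assume k: "k < length (Q @ relocate loc (length Q) P)"
  show "case (Q @ relocate loc (length Q) P) ! k of
          (\<alpha>, u, v) \<Rightarrow> operand_ok I k u \<and> operand_ok I k v"
  proof (cases "k < length Q")
    case True
    with Q show ?thesis by (auto simp: program_ok_def nth_append)
  next
    case False
    then obtain k' where k': "k = length Q + k'" by (metis le_Suc_ex not_less)
    obtain \<alpha> u v where step: "P ! k' = (\<alpha>, u, v)" by (cases "P ! k'")
    have "k' < length P" using k k' by simp
    with P step have "operand_ok I' k' u" "operand_ok I' k' v" by (auto simp: program_ok_def)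
    then show ?thesis
      using \<open>k' < length P\<close> loc
      by (simp add: k' relocate_def step operand_ok_relocate)
  qed
qed

lemma run_relocate:
  assumes P: "program_ok I' P"
    and ok: "\<And>i. i \<in> I' \<Longrightarrow> operand_ok I (length vs) (loc i)"
    and val: "\<And>i. i \<in> I' \<Longrightarrow> operand_value x vs (loc i) = y i"
  shows "run x vs (relocate loc (length vs) P) = vs @ run y [] P"
  using P
proof (induction P rule: rev_induct)
  case Nil
  show ?case by (simp add: relocate_def)
next
  case (snoc step P)
  obtain \<alpha> u v where step: "step = (\<alpha>, u, v)" by (cases step)
  have "program_ok I' P"
    using snoc.prems by (auto simp: program_ok_def nth_append split: if_splits)
  note IH = snoc.IH[OF this]
  have u: "operand_ok I' (length P) u" and v: "operand_ok I' (length P) v"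
    using snoc.prems by (auto simp: program_ok_def step)
  have "operand_value x (vs @ run y [] P) (relocate_operand loc (length vs) w)
      = operand_value y (run y [] P) w" if "operand_ok I' (length P) w" for w
    using operand_value_relocate[OF that _ ok val] by simp
  with IH u v show ?case by (simp add: relocate_def run_append step)
qed

lemma ops_required_le: "computes F I inp J out P \<Longrightarrow> ops_required F I inp J out \<le> enat (length P)"
  unfolding ops_required_def by (rule INF_lower) simp

lemma optimal_program:
  assumes "ops_required F I inp J out \<noteq> \<infinity>"
  obtains P where "computes F I inp J out P" "enat (length P) = ops_required F I inp J out"
proof -
  let ?L = "(\<lambda>P. enat (length P)) ` {P. computes F I inp J out P}"
  have "Inf ?L \<noteq> \<infinity>" using assms by (simp add: ops_required_def)
  then have "?L \<noteq> {}" by (metis Inf_enat_def)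
  then obtain l where "l \<in> ?L" by blast
  then have "Inf ?L \<in> ?L" by (rule wellorder_InfI)
  then show thesis using that by (auto simp: ops_required_def)
qed

text \<open>The basic composition step.  A second problem is solved behind a first one; each of its
  inputs is either an input or a result of the first, as given by \<open>h\<close>, and it is solved for an
  instance \<open>\<phi> f\<close> derived from the instance \<open>f\<close>.  Sequential and parallel composition are the
  extreme cases in which \<open>h\<close> only takes values \<open>Inr\<close> or only values \<open>Inl\<close>.\<close>

lemma ops_required_append:
  assumes \<phi>: "\<And>f. f \<in> F \<Longrightarrow> \<phi> f \<in> F'"
    and h: "\<And>i. i \<in> I' \<Longrightarrow> h i \<in> I <+> J"
    and inp': "\<And>f i. f \<in> F \<Longrightarrow> i \<in> I' \<Longrightarrow> inp' (\<phi> f) i = case_sum (inp f) (mid f) (h i)"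
  shows "ops_required F I inp (J <+> K) (\<lambda>f. case_sum (mid f) (out (\<phi> f)))
    \<le> ops_required F I inp J mid + ops_required F' I' inp' K out"
proof (cases "ops_required F I inp J mid = \<infinity> \<or> ops_required F' I' inp' K out = \<infinity>")
  case True
  then show ?thesis by auto
next
  case False
  then obtain Q P where Q: "computes F I inp J mid Q"
      and lQ: "enat (length Q) = ops_required F I inp J mid"
    and P: "computes F' I' inp' K out P"
      and lP: "enat (length P) = ops_required F' I' inp' K out"
    by (metis optimal_program)
  from Q obtain qQ where Q_ok: "program_ok I Q"
    and qQ_ok: "\<And>j. j \<in> J \<Longrightarrow> operand_ok I (length Q) (qQ j)"
    and qQ: "\<And>f j. f \<in> F \<Longrightarrow> j \<in> J \<Longrightarrow> operand_value (inp f) (run (inp f) [] Q) (qQ j) = mid f j"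
    by (auto simp: computes_def)
  from P obtain qP where P_ok: "program_ok I' P"
    and qP_ok: "\<And>j. j \<in> K \<Longrightarrow> operand_ok I' (length P) (qP j)"
    and qP: "\<And>f j. f \<in> F' \<Longrightarrow> j \<in> K \<Longrightarrow> operand_value (inp' f) (run (inp' f) [] P) (qP j) = out f j"
    by (auto simp: computes_def)
  define loc where "loc i = case_sum Inp qQ (h i)" for i
  define R where "R = Q @ relocate loc (length Q) P"
  define q where "q = case_sum qQ (\<lambda>k. relocate_operand loc (length Q) (qP k))"
  have loc_ok: "operand_ok I (length Q) (loc i)" if "i \<in> I'" for i
    using h[OF that] by (auto simp: loc_def qQ_ok)
  have loc_val: "operand_value (inp f) (run (inp f) [] Q) (loc i) = inp' (\<phi> f) i"
    if "f \<in> F" "i \<in> I'" for f i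
    using h[OF that(2)] by (auto simp: loc_def qQ inp' that)
  have run_R: "run (inp f) [] R = run (inp f) [] Q @ run (inp' (\<phi> f)) [] P" if "f \<in> F" for f
    using run_relocate[OF P_ok, of I "run (inp f) [] Q" loc "inp f" "inp' (\<phi> f)"] loc_ok loc_val that
    by (simp add: R_def run_append)
  have "computes F I inp (J <+> K) (\<lambda>f. case_sum (mid f) (out (\<phi> f))) R"
    unfolding computes_def
  proof (intro conjI exI[of _ q] ballI)
    show "program_ok I R"
      unfolding R_def by (rule program_ok_append_relocate[OF Q_ok P_ok loc_ok])
    show "operand_ok I (length R) (q j)" if "j \<in> J <+> K" for j
      using that operand_ok_mono[OF qQ_ok, of _ "length R"] operand_ok_relocate[OF qP_ok loc_ok]
      by (auto simp: q_def R_def)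
    show "operand_value (inp f) (run (inp f) [] R) (q j) = case_sum (mid f) (out (\<phi> f)) j"
      if "f \<in> F" "j \<in> J <+> K" for f j
      using \<open>j \<in> J <+> K\<close>
    proof (rule PlusE)
      fix k assume "k \<in> J" "j = Inl k"
      with that(1) show ?thesis
        using operand_value_append[of I "run (inp f) [] Q" "qQ k"] qQ_ok qQ by (simp add: run_R q_def)
    next
      fix k assume "k \<in> K" "j = Inr k"
      with that(1) show ?thesis
        using operand_value_relocate[OF qP_ok, of k "run (inp' (\<phi> f)) [] P" I "run (inp f) [] Q" loc
            "inp f" "inp' (\<phi> f)"] loc_ok loc_val qP \<phi>
        by (simp add: run_R q_def)
    qed
  qed
  from ops_required_le[OF this] show ?thesis by (simp add: R_def flip: lQ lP)
qed

text \<open>Omitting, repeating or renaming results costs nothing.\<close>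

lemma ops_required_select:
  assumes g: "\<And>j. j \<in> J' \<Longrightarrow> g j \<in> J" and out: "\<And>f j. f \<in> F \<Longrightarrow> j \<in> J' \<Longrightarrow> out' f j = out f (g j)"
  shows "ops_required F I inp J' out' \<le> ops_required F I inp J out"
proof (cases "ops_required F I inp J out = \<infinity>")
  case False
  then obtain P where P: "computes F I inp J out P" "enat (length P) = ops_required F I inp J out"
    by (rule optimal_program)
  from P(1) obtain q where "program_ok I P" "\<forall>j\<in>J. operand_ok I (length P) (q j)"
    "\<forall>f\<in>F. \<forall>j\<in>J. operand_value (inp f) (run (inp f) [] P) (q j) = out f j"
    by (auto simp: computes_def)
  then have "computes F I inp J' out' P"
    unfolding computes_def using g out by (auto intro!: exI[of _ "q \<circ> g"])
  from ops_required_le[OF this] P(2) show ?thesis by simp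
qed simp

lemma ops_required_no_output: "ops_required F I inp {} out = 0"
proof -
  have "computes F I inp {} out []" by (simp add: computes_def program_ok_def)
  from ops_required_le[OF this] show ?thesis by (simp add: zero_enat_def[symmetric])
qed

text \<open>A problem that is another one in disguise: the inputs of the latter occur among the given
  data, and its results contain the required ones.\<close>

lemma ops_required_reduce:
  assumes \<phi>: "\<And>f. f \<in> F \<Longrightarrow> \<phi> f \<in> F'"
    and h: "\<And>i. i \<in> I' \<Longrightarrow> h i \<in> I"
    and inp': "\<And>f i. f \<in> F \<Longrightarrow> i \<in> I' \<Longrightarrow> inp' (\<phi> f) i = inp f (h i)"
    and g: "\<And>j. j \<in> J \<Longrightarrow> g j \<in> J'"
    and out: "\<And>f j. f \<in> F \<Longrightarrow> j \<in> J \<Longrightarrow> out f j = out' (\<phi> f) (g j)"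
  shows "ops_required F I inp J out \<le> ops_required F' I' inp' J' out'"
proof -
  \<comment> \<open>Append the program to the empty one, which computes nothing.\<close>
  let ?mid = "\<lambda>_ _ :: unit. 0 :: complex"
  let ?out = "\<lambda>f. case_sum (?mid f) (out' (\<phi> f))"
  have "ops_required F I inp J out \<le> ops_required F I inp ({} <+> J') ?out"
    by (rule ops_required_select[where g = "\<lambda>j. Inr (g j)"]) (auto simp: g out)
  also have "\<dots> \<le> ops_required F I inp {} ?mid + ops_required F' I' inp' J' out'"
    by (rule ops_required_append[where h = "\<lambda>i. Inl (h i)" and mid = ?mid]) (auto simp: \<phi> h inp')
  finally show ?thesis by (simp add: ops_required_no_output)
qed

lemma ops_required_comp:
  assumes \<phi>: "\<And>f. f \<in> F \<Longrightarrow> \<phi> f \<in> F'"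
    and inp': "\<And>f j. f \<in> F \<Longrightarrow> j \<in> J \<Longrightarrow> inp' (\<phi> f) j = mid f j"
    and out: "\<And>f k. f \<in> F \<Longrightarrow> k \<in> K \<Longrightarrow> out f k = out' (\<phi> f) k"
  shows "ops_required F I inp K out \<le> ops_required F I inp J mid + ops_required F' J inp' K out'"
proof -
  have "ops_required F I inp K out
      \<le> ops_required F I inp (J <+> K) (\<lambda>f. case_sum (mid f) (out' (\<phi> f)))"
    by (rule ops_required_select[where g = Inr]) (auto simp: out)
  also have "\<dots> \<le> ops_required F I inp J mid + ops_required F' J inp' K out'"
    by (rule ops_required_append[where h = Inr]) (auto simp: \<phi> inp')
  finally show ?thesis .
qed

lemma ops_required_Sigma:
  assumes "finite A"
  shows "ops_required F I inp (Sigma A J) (\<lambda>f (a, j). out a f j)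
    \<le> (\<Sum>a\<in>A. ops_required F I inp (J a) (out a))"
  using assms
proof (induction A rule: finite_induct)
  case empty
  show ?case by (simp add: ops_required_no_output)
next
  case (insert a A)
  let ?out = "\<lambda>f (a, j). out a f j"
  have "ops_required F I inp (Sigma (insert a A) J) ?out
      \<le> ops_required F I inp (J a <+> Sigma A J) (\<lambda>f. case_sum (out a f) (?out f))"
    by (rule ops_required_select[where g = "\<lambda>(b, j). if b = a then Inl j else Inr (b, j)"]) auto
  also have "\<dots> \<le> ops_required F I inp (J a) (out a) + ops_required F I inp (Sigma A J) ?out"
    by (rule ops_required_append[where h = Inl and \<phi> = id, simplified]) auto
  also have "\<dots> \<le> ops_required F I inp (J a) (out a)
      + (\<Sum>a\<in>A. ops_required F I inp (J a) (out a))"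
    by (rule add_left_mono) (rule insert.IH)
  finally show ?case using insert.hyps by simp
qed

section \<open>Block structure of the induced representations\<close>

lemma linear_on_salg_dim:
  assumes "linear_on_salg A d \<rho>"
  shows "rep_dim \<rho> = d"
proof -
  have "(\<lambda>_. 0) \<in> salg A" by (simp add: salg_def)
  with assms have "\<rho> (\<lambda>_. 0) \<in> carrier_mat d d" unfolding linear_on_salg_def by blast
  then show ?thesis by (simp add: rep_dim_def)
qed

text \<open>Expansion in the basis of the elements of \<open>A\<close>, by induction on the part of the support that
  has been collected.\<close>

lemma linear_on_salg_entry:
  fixes A :: "'a::finite set"
  assumes lin: "linear_on_salg A d \<rho>" and f: "f \<in> salg A" and ij: "i < d" "j < d"
  shows "\<rho> f $$ (i, j) = (\<Sum>s\<in>A. f s * \<rho> (elem s) $$ (i, j))"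
proof -
  have dim: "\<rho> g \<in> carrier_mat d d" if "g \<in> salg A" for g
    using lin that by (simp add: linear_on_salg_def)
  have elem: "elem s \<in> salg A" if "s \<in> A" for s using that by (auto simp: salg_def elem_def)
  have smult: "\<rho> (\<lambda>s. c * g s) $$ (i, j) = c * \<rho> g $$ (i, j)" if "g \<in> salg A" for c g
  proof -
    have "\<rho> (\<lambda>s. c * g s) = c \<cdot>\<^sub>m \<rho> g" using lin that by (simp add: linear_on_salg_def)
    with dim[OF that] ij show ?thesis by simp
  qed
  have add: "\<rho> (\<lambda>s. g s + h s) $$ (i, j) = \<rho> g $$ (i, j) + \<rho> h $$ (i, j)"
    if "g \<in> salg A" "h \<in> salg A" for g h
  proof -
    have "\<rho> (\<lambda>s. g s + h s) = \<rho> g + \<rho> h" using lin that by (simp add: linear_on_salg_def)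
    with dim[OF that(1)] dim[OF that(2)] ij show ?thesis by simp
  qed
  have "\<rho> (\<lambda>s. if s \<in> B then f s else 0) $$ (i, j) = (\<Sum>s\<in>B. f s * \<rho> (elem s) $$ (i, j))"
    if "B \<subseteq> A" for B
    using finite[of B] that
  proof (induction B rule: finite_induct)
    case empty
    show ?case using smult[of "\<lambda>_. 0" 0] by (simp add: salg_def)
  next
    case (insert x B)
    have split: "(\<lambda>s. if s \<in> insert x B then f s else 0)
        = (\<lambda>s. f x * elem x s + (if s \<in> B then f s else 0))"
      using insert.hyps by (auto simp: elem_def)
    have "(\<lambda>s. f x * elem x s) \<in> salg A" "(\<lambda>s. if s \<in> B then f s else 0) \<in> salg A"
      using insert.prems by (auto simp: salg_def elem_def)
    with insert show ?case by (simp only: split add) (simp add: smult elem)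
  qed
  moreover have "(\<lambda>s. if s \<in> A then f s else 0) = f" using f by (auto simp: salg_def)
  ultimately show ?thesis by (metis subset_refl)
qed

lemma kronecker_carrier:
  "B \<in> carrier_mat d d \<Longrightarrow> kronecker (mat_unit r a b) B \<in> carrier_mat (r * d) (r * d)"
  by (simp add: kronecker_def mat_unit_def)

lemma block_index_less:
  fixes a i d r :: nat
  assumes "a < r" "i < d"
  shows "a * d + i < r * d"
proof -
  have "a * d + i < (a + 1) * d" using assms by simp
  also have "\<dots> \<le> r * d" using assms by (intro mult_right_mono) auto
  finally show ?thesis .
qed

lemma kronecker_mat_unit_entry:
  assumes "B \<in> carrier_mat d d" "a' < r" "b' < r" "i < d" "j < d"
  shows "kronecker (mat_unit r a b) B $$ (a' * d + i, b' * d + j)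
    = (if a' = a \<and> b' = b then B $$ (i, j) else 0)"
  using assms block_index_less[of a' r i d] block_index_less[of b' r j d]
  by (simp add: kronecker_def mat_unit_def)

text \<open>The linear map with the values on the groupoid basis that define the representation induced
  by \<open>\<rho>\<close>, written out with the coordinates \<open>upper_sum f\<close>.\<close>

definition induced_rep ::
  "('a \<Rightarrow> 'a) \<Rightarrow> ('a \<Rightarrow> nat) \<Rightarrow> 'a::{inverse_semigroup, finite} set \<Rightarrow> 'a rep \<Rightarrow> 'a rep" where
  "induced_rep p idx D \<rho> f =
     (let r = card (D \<inter> idems); N = r * rep_dim \<rho> in
        mat N N (\<lambda>ij. \<Sum>s\<in>D. upper_sum f s *
          kronecker (mat_unit r (idx (sran s)) (idx (sdom s)))
            (\<rho> (elem (sinv (p (sran s)) * s * p (sdom s)))) $$ ij))"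

lemma is_induced_induced_rep:
  assumes D: "D \<in> UNIV // D_rel"
    and p: "\<And>a. a \<in> D \<inter> idems \<Longrightarrow> sdom (p a) = e \<and> sran (p a) = a"
    and lin: "linear_on_salg (max_subgroup e) (rep_dim \<rho>) \<rho>"
  shows "is_induced p idx D \<rho> (induced_rep p idx D \<rho>)"
proof -
  define r where "r = card (D \<inter> idems)"
  define N where "N = r * rep_dim \<rho>"
  define M where "M s = kronecker (mat_unit r (idx (sran s)) (idx (sdom s)))
            (\<rho> (elem (sinv (p (sran s)) * s * p (sdom s))))" for s
  have M: "M s \<in> carrier_mat N N" if "s \<in> D" for s
  proof -
    have "sinv (p (sran s)) * s * p (sdom s) \<in> max_subgroup e"
      using p sran_in_D_class[OF D that] sdom_in_D_class[OF D that]
        bij_betw_apply[OF bij_betw_max_subgroup] by blast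
    then have "elem (sinv (p (sran s)) * s * p (sdom s)) \<in> salg (max_subgroup e)"
      by (auto simp: salg_def elem_def)
    with lin show ?thesis unfolding M_def N_def
      by (intro kronecker_carrier) (simp add: linear_on_salg_def)
  qed
  have eq: "induced_rep p idx D \<rho> f = mat N N (\<lambda>ij. \<Sum>s\<in>D. upper_sum f s * M s $$ ij)" for f
    by (simp add: induced_rep_def Let_def r_def N_def M_def)
  have "linear_on_salg UNIV N (induced_rep p idx D \<rho>)"
    unfolding linear_on_salg_def eq
    by (auto intro!: eq_matI
        simp: upper_sum_def sum.distrib ring_distribs sum_distrib_left[symmetric] mult.assoc)
  moreover have "induced_rep p idx D \<rho> \<lfloor>s\<rfloor>\<^sub>G = (if s \<in> D then M s else 0\<^sub>m N N)" for s
    unfolding eq upper_sum_groupoid_basis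
    using carrier_matD[OF M] by (auto intro!: eq_matI simp: elem_def if_distrib if_distribR sum.delta cong: if_cong)
  ultimately show ?thesis
    unfolding is_induced_def Let_def r_def[symmetric] N_def[symmetric] M_def by blast
qed

text \<open>The coordinates of \<open>f\<close> at the elements with range \<open>a\<close> and domain \<open>b\<close>, carried over
  to the maximal subgroup along the connecting elements.\<close>

definition subgroup_part ::
  "('a \<Rightarrow> 'a) \<Rightarrow> 'a \<Rightarrow> 'a \<Rightarrow> 'a \<Rightarrow> ('a::{inverse_semigroup, finite} \<Rightarrow> complex) \<Rightarrow> 'a \<Rightarrow> complex" where
  "subgroup_part p e a b f g =
     (if g \<in> max_subgroup e then upper_sum f (p a * g * sinv (p b)) else 0)"

lemma subgroup_part_in_salg: "subgroup_part p e a b f \<in> salg (max_subgroup e)"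
  by (simp add: salg_def subgroup_part_def)

lemma subgroup_part_transport:
  assumes "sdom (p (sran s)) = e" "sran (p (sran s)) = sran s"
    and "sdom (p (sdom s)) = e" "sran (p (sdom s)) = sdom s"
  shows "subgroup_part p e (sran s) (sdom s) f (sinv (p (sran s)) * s * p (sdom s)) = upper_sum f s"
proof -
  have "sinv (p (sran s)) * s * p (sdom s) \<in> max_subgroup e"
    using bij_betw_apply[OF bij_betw_max_subgroup] assms by blast
  moreover have "p (sran s) * (sinv (p (sran s)) * s * p (sdom s)) * sinv (p (sdom s)) = s"
  proof -
    have "p (sran s) * sinv (p (sran s)) * s * (p (sdom s) * sinv (p (sdom s))) = s"
      using assms by (metis mult_sdom sran_mult sran_def)
    then show ?thesis by (simp add: mult.assoc)
  qed
  ultimately show ?thesis by (simp add: subgroup_part_def)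
qed

text \<open>In the sum over \<open>D\<close>, the matrix units delete every term outside the \<open>\<H>\<close>-class of
  range \<open>a\<close> and domain \<open>b\<close>.  Reindexing this class by the subgroup gives the expansion of \<open>\<rho>\<close> at
  the transported function.\<close>

lemma induced_rep_block:
  assumes D: "D \<in> UNIV // D_rel"
    and p: "\<And>a. a \<in> D \<inter> idems \<Longrightarrow> sdom (p a) = e \<and> sran (p a) = a"
    and idx: "bij_betw idx (D \<inter> idems) {..<card (D \<inter> idems)}"
    and lin: "linear_on_salg (max_subgroup e) d \<rho>"
    and a: "a \<in> D \<inter> idems" and b: "b \<in> D \<inter> idems" and ij: "i < d" "j < d"
  shows "induced_rep p idx D \<rho> f $$ (idx a * d + i, idx b * d + j)
    = \<rho> (subgroup_part p e a b f) $$ (i, j)"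
proof -
  define r where "r = card (D \<inter> idems)"
  define g where "g s = sinv (p (sran s)) * s * p (sdom s)" for s
  let ?H = "{s. sran s = a \<and> sdom s = b}"
  have d: "rep_dim \<rho> = d" by (rule linear_on_salg_dim[OF lin])
  have idx_less: "idx c < r" if "c \<in> D \<inter> idems" for c
    using bij_betw_apply[OF idx that] by (simp add: r_def)
  have idx_eq: "idx c = idx c' \<longleftrightarrow> c = c'" if "c \<in> D \<inter> idems" "c' \<in> D \<inter> idems" for c c'
    using idx that by (meson bij_betw_imp_inj_on inj_on_eq_iff)
  have dim: "\<rho> (elem (g s)) \<in> carrier_mat d d" if "s \<in> D" for s
  proof -
    have "g s \<in> max_subgroup e"
      using p sran_in_D_class[OF D that] sdom_in_D_class[OF D that]
        bij_betw_apply[OF bij_betw_max_subgroup] unfolding g_def by blast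
    then have "elem (g s) \<in> salg (max_subgroup e)" by (auto simp: salg_def elem_def)
    with lin show ?thesis by (simp add: linear_on_salg_def)
  qed
  have HD: "?H \<subseteq> D" using a in_D_class_if_sran_in[OF D] by blast
  have bij: "bij_betw g ?H (max_subgroup e)"
  proof -
    have "bij_betw (\<lambda>s. sinv (p a) * s * p b) ?H (max_subgroup e)"
      using bij_betw_max_subgroup p a b by blast
    then show ?thesis by (rule bij_betw_cong[THEN iffD1, rotated]) (auto simp: g_def)
  qed
  have "induced_rep p idx D \<rho> f $$ (idx a * d + i, idx b * d + j)
      = (\<Sum>s\<in>D. upper_sum f s * kronecker (mat_unit r (idx (sran s)) (idx (sdom s))) (\<rho> (elem (g s)))
            $$ (idx a * d + i, idx b * d + j))"
    using block_index_less[OF idx_less[OF a] ij(1)] block_index_less[OF idx_less[OF b] ij(2)]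
    by (simp add: induced_rep_def Let_def d r_def g_def)
  also have "\<dots> = (\<Sum>s\<in>D. if s \<in> ?H then upper_sum f s * \<rho> (elem (g s)) $$ (i, j) else 0)"
    using idx_eq[OF a sran_in_D_class[OF D]] idx_eq[OF b sdom_in_D_class[OF D]]
    by (intro sum.cong refl)
       (auto simp: kronecker_mat_unit_entry[OF dim idx_less[OF a] idx_less[OF b] ij])
  also have "\<dots> = (\<Sum>s\<in>?H. upper_sum f s * \<rho> (elem (g s)) $$ (i, j))"
    using HD by (intro sum.mono_neutral_cong_right) auto
  also have "\<dots> = (\<Sum>s\<in>?H. subgroup_part p e a b f (g s) * \<rho> (elem (g s)) $$ (i, j))"
  proof (rule sum.cong[OF refl])
    fix s assume "s \<in> ?H"
    then have "subgroup_part p e a b f (g s) = upper_sum f s"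
      using subgroup_part_transport[of p s e f] p a b unfolding g_def by blast
    then show "upper_sum f s * \<rho> (elem (g s)) $$ (i, j)
        = subgroup_part p e a b f (g s) * \<rho> (elem (g s)) $$ (i, j)" by simp
  qed
  also have "\<dots> = (\<Sum>x\<in>max_subgroup e. subgroup_part p e a b f x * \<rho> (elem x) $$ (i, j))"
    by (rule sum.reindex_bij_betw[OF bij])
  also have "\<dots> = \<rho> (subgroup_part p e a b f) $$ (i, j)"
    by (rule linear_on_salg_entry[OF lin subgroup_part_in_salg ij, symmetric])
  finally show ?thesis .
qed

section \<open>The operation count\<close>

theorem theorem4p1:
  fixes D :: "nat \<Rightarrow> 'a::{inverse_semigroup, finite} set"
    and n :: nat
    and r :: "nat \<Rightarrow> nat"
    and e :: "nat \<Rightarrow> 'a"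
    and G :: "nat \<Rightarrow> 'a set"
    and IRR :: "nat \<Rightarrow> 'a rep set"
    and p :: "'a \<Rightarrow> 'a"
    and idx :: "'a \<Rightarrow> nat"
    and Y :: "'a rep set"
  assumes D_classes: "bij_betw D {..n} (UNIV // D_rel)"
    and r: "\<And>k. k \<le> n \<Longrightarrow> r k = card (D k \<inter> idems)"
    and e: "\<And>k. k \<le> n \<Longrightarrow> e k \<in> D k \<inter> idems"
    and G: "\<And>k. k \<le> n \<Longrightarrow> G k = max_subgroup (e k)"
    and IRR: "\<And>k. k \<le> n \<Longrightarrow> complete_irreps (G k) (IRR k)"
    and p: "\<And>k a. k \<le> n \<Longrightarrow> a \<in> D k \<inter> idems \<Longrightarrow> sdom (p a) = e k \<and> sran (p a) = a"
    and p_base: "\<And>k. k \<le> n \<Longrightarrow> p (e k) = e k"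
    and idx: "\<And>k. k \<le> n \<Longrightarrow> bij_betw idx (D k \<inter> idems) {..<r k}"
    and Y: "Y = {\<sigma>. \<exists>k\<le>n. \<exists>\<rho>\<in>IRR k. is_induced p idx (D k) \<rho> \<sigma>}"
  shows "ift_ops UNIV Y \<le> mobius_ops TYPE('a) + (\<Sum>k\<le>n. enat ((r k)\<^sup>2) * ift_ops (G k) (IRR k))"
proof -
  define I where "I = {(\<sigma>, i, j). \<sigma> \<in> Y \<and> i < rep_dim \<sigma> \<and> j < rep_dim \<sigma>}"
  define inp :: "('a \<Rightarrow> complex) \<Rightarrow> 'a rep \<times> nat \<times> nat \<Rightarrow> complex"
    where "inp = (\<lambda>f (\<sigma>, i, j). \<sigma> f $$ (i, j))"
  define E where "E k = D k \<inter> idems" for k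
  define A where "A = (SIGMA k:{..n}. E k \<times> E k)"
  have Dk: "D k \<in> UNIV // D_rel" if "k \<le> n" for k
    using D_classes that by (simp add: bij_betw_apply)
  have lin: "linear_on_salg (G k) (rep_dim \<rho>) \<rho>" if "k \<le> n" "\<rho> \<in> IRR k" for k \<rho>
    using IRR[OF that(1)] that(2)
    by (auto simp: complete_irreps_def irreducible_rep_def representation_def)
  have induced: "is_induced p idx (D k) \<rho> (induced_rep p idx (D k) \<rho>)" if "k \<le> n" "\<rho> \<in> IRR k" for k \<rho>
    using is_induced_induced_rep[OF Dk[OF that(1)] p[OF that(1)]] lin[OF that] G[OF that(1)] by simp

  \<comment> \<open>The transform of \<open>subgroup_part p (e k) a b f\<close> at \<open>\<rho>\<close> is already among the data, as a block of
    the matrix for the representation induced by \<open>\<rho>\<close>.\<close>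
  have block: "ops_required UNIV I inp (G k) (subgroup_part p (e k) a b) \<le> ift_ops (G k) (IRR k)"
    if "k \<le> n" "a \<in> E k" "b \<in> E k" for k a b
    unfolding ift_ops_def
  proof (rule ops_required_reduce[where \<phi> = "subgroup_part p (e k) a b" and g = id
        and h = "\<lambda>(\<rho>, i, j). (induced_rep p idx (D k) \<rho>,
                   idx a * rep_dim \<rho> + i, idx b * rep_dim \<rho> + j)"], goal_cases)
    case (1 f)
    show ?case using G[OF that(1)] by (simp add: subgroup_part_in_salg)
  next
    case (2 x)
    then obtain \<rho> i j where x: "x = (\<rho>, i, j)" and \<rho>: "\<rho> \<in> IRR k" and ij: "i < rep_dim \<rho>" "j < rep_dim \<rho>"
      by auto
    have ab: "idx a < r k" "idx b < r k"
      using that by (auto simp: E_def dest: bij_betw_apply[OF idx])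
    have "induced_rep p idx (D k) \<rho> \<in> Y" using induced[OF that(1) \<rho>] that(1) \<rho> Y by blast
    moreover have "rep_dim (induced_rep p idx (D k) \<rho>) = r k * rep_dim \<rho>"
      by (simp add: rep_dim_def induced_rep_def Let_def r[OF that(1)])
    ultimately show ?case using ij ab by (simp add: x I_def block_index_less)
  next
    case (3 f x)
    then obtain \<rho> i j where x: "x = (\<rho>, i, j)" and \<rho>: "\<rho> \<in> IRR k" and ij: "i < rep_dim \<rho>" "j < rep_dim \<rho>"
      by auto
    have "induced_rep p idx (D k) \<rho> f $$ (idx a * rep_dim \<rho> + i, idx b * rep_dim \<rho> + j)
        = \<rho> (subgroup_part p (e k) a b f) $$ (i, j)"
      using that ij r[OF that(1)] idx[OF that(1)] lin[OF that(1) \<rho>] G[OF that(1)]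
      by (intro induced_rep_block[OF Dk[OF that(1)] p[OF that(1)]]) (simp_all add: E_def)
    then show ?case by (simp add: x inp_def)
  qed simp_all

  \<comment> \<open>Every element lies in exactly one block, so the blocks together contain all coordinates.\<close>
  let ?parts = "\<lambda>f ((k, a, b), x). subgroup_part p (e k) a b f x"
  have coordinates: "ops_required UNIV I inp UNIV upper_sum \<le> ops_required UNIV I inp (SIGMA (k, a, b):A. G k) ?parts"
  proof -
    have "\<exists>y\<in>(SIGMA (k, a, b):A. G k). \<forall>f. upper_sum f s = ?parts f y" for s :: 'a
    proof -
      have "D_rel `` {s} \<in> D ` {..n}"
        using D_classes by (simp add: bij_betw_imp_surj_on quotientI)
      then obtain k where k: "k \<le> n" and "D k = D_rel `` {s}" by auto
      then have s: "s \<in> D k" using equiv_class_self[OF equiv_D_rel] by simp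
      let ?a = "sran s" and ?b = "sdom s"
      have a: "?a \<in> D k \<inter> idems" and b: "?b \<in> D k \<inter> idems"
        using sran_in_D_class[OF Dk[OF k] s] sdom_in_D_class[OF Dk[OF k] s] by auto
      note pa = p[OF k a] and pb = p[OF k b]
      have "sinv (p ?a) * s * p ?b \<in> G k"
        using bij_betw_apply[OF bij_betw_max_subgroup] pa pb G[OF k] by blast
      moreover have "subgroup_part p (e k) ?a ?b f (sinv (p ?a) * s * p ?b) = upper_sum f s" for f
        using subgroup_part_transport pa pb by blast
      ultimately show ?thesis using k a b
        by (intro bexI[of _ "((k, ?a, ?b), sinv (p ?a) * s * p ?b)"]) (auto simp: A_def E_def)
    qed
    then obtain y where "\<And>s. y s \<in> (SIGMA (k, a, b):A. G k)" "\<And>s f. upper_sum f s = ?parts f (y s)"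
      by metis
    then show ?thesis by (intro ops_required_select[where g = y]) blast+
  qed

  have "ift_ops UNIV Y = ops_required UNIV I inp UNIV (\<lambda>f s. f s)"
    by (simp add: ift_ops_def I_def inp_def salg_def)
  also have "\<dots> \<le> ops_required UNIV I inp UNIV upper_sum + mobius_ops TYPE('a)"
    unfolding mobius_ops_def
    by (rule ops_required_comp[where \<phi> = upper_sum])
       (simp_all add: mobius_transform_upper_sum flip: mobius_transform_def)
  also have "ops_required UNIV I inp UNIV upper_sum \<le> ops_required UNIV I inp (SIGMA (k, a, b):A. G k) ?parts"
    by (rule coordinates)
  also have "\<dots> \<le> (\<Sum>(k, a, b)\<in>A. ops_required UNIV I inp (G k) (subgroup_part p (e k) a b))"
    using ops_required_Sigma[of A UNIV I inp "\<lambda>(k, a, b). G k" "\<lambda>(k, a, b). subgroup_part p (e k) a b"]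
    by (simp add: A_def split_def)
  also have "\<dots> \<le> (\<Sum>(k, a, b)\<in>A. ift_ops (G k) (IRR k))"
    by (intro sum_mono) (auto simp: A_def block)
  also have "\<dots> = (\<Sum>k\<le>n. \<Sum>ab\<in>E k \<times> E k. ift_ops (G k) (IRR k))"
    unfolding A_def by (subst sum.Sigma) (auto simp: split_def)
  also have "\<dots> = (\<Sum>k\<le>n. enat ((r k)\<^sup>2) * ift_ops (G k) (IRR k))"
    by (intro sum.cong refl)
       (simp add: r E_def card_cartesian_product power2_eq_square of_nat_eq_enat[symmetric])
  finally show ?thesis by (simp add: add.commute add_mono)
qed

end
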